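(* Let $0<q\le1$, let $\phi\in H^\infty(\mathbb{D})$, and let $M_\phi$ be the multiplication operator $(M_\phi f)(z)=\phi(z)f(z)$ on $H^2(\mathbb{D})$. Then $\mathrm{Ber}_q(M_\phi)$ is convex if and only if $\phi(\mathbb{D})$ is convex.
   Context: $\mathbb{D}$ is the open unit disc in $\mathbb{C}$; $H^\infty(\mathbb{D})$ is the algebra of bounded analytic functions on $\mathbb{D}$. $H^2(\mathbb{D})$ is the Hardy space of analytic functions $\sum_{n\ge0}a_nz^n$ on $\mathbb{D}$ with $\sum|a_n|^2<\infty$ and inner product $\langle\sum a_nz^n,\sum b_nz^n\rangle=\sum a_n\overline{b_n}$. Its reproducing kernel at $w\in\mathbb{D}$ is $k_w(z)=\frac{1}{1-\overline{w}z}$, and $\hat{k}_w=k_w/\|k_w\|$. For a bounded linear operator $T$ on $H^2(\mathbb{D})$ and $0<q\le1$, the $q$-Berezin range is $\mathrm{Ber}_q(T)=\{\langle T\hat{k}_{w_1},\hat{k}_{w_2}\rangle: w_1,w_2\in\mathbb{D},\ \langle\hat{k}_{w_1},\hat{k}_{w_2}\rangle=q\}$. *)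

theory Defs
  imports "HOL-Complex_Analysis.Complex_Analysis"
begin

abbreviation unit_disc :: "complex set"
  where "unit_disc \<equiv> ball 0 1"

abbreviation taylor_coeff :: "(complex \<Rightarrow> complex) \<Rightarrow> nat \<Rightarrow> complex"
  where "taylor_coeff f n \<equiv> fps_nth (fps_expansion f 0) n"

text \<open>
  A function on the disc is represented by its extension by zero to the whole plane, so that
  equality of elements of the Hardy space is equality in HOL.
\<close>
definition hardy_space :: "(complex \<Rightarrow> complex) set"
  where "hardy_space =
    {f. f holomorphic_on unit_disc \<and> (\<forall>z. z \<notin> unit_disc \<longrightarrow> f z = 0) \<and>
        summable (\<lambda>n. (norm (taylor_coeff f n))\<^sup>2)}"

definition hardy_inner :: "(complex \<Rightarrow> complex) \<Rightarrow> (complex \<Rightarrow> complex) \<Rightarrow> complex"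
  where "hardy_inner f g = (\<Sum>n. taylor_coeff f n * cnj (taylor_coeff g n))"

definition hardy_norm :: "(complex \<Rightarrow> complex) \<Rightarrow> real"
  where "hardy_norm f = sqrt (Re (hardy_inner f f))"

definition szego_kernel :: "complex \<Rightarrow> complex \<Rightarrow> complex"
  where "szego_kernel w z = (if z \<in> unit_disc then 1 / (1 - cnj w * z) else 0)"

definition normalized_kernel :: "complex \<Rightarrow> complex \<Rightarrow> complex"
  where "normalized_kernel w z = szego_kernel w z / of_real (hardy_norm (szego_kernel w))"

definition H_infinity :: "(complex \<Rightarrow> complex) set"
  where "H_infinity = {\<phi>. \<phi> holomorphic_on unit_disc \<and> bounded (\<phi> ` unit_disc)}"

text \<open>
  Operators on the Hardy space are maps on its carrier, undefined elsewhere. The values of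
  \<open>\<phi>\<close> outside the disc are irrelevant, since \<open>f\<close> vanishes there.
\<close>
definition mult_op :: "(complex \<Rightarrow> complex) \<Rightarrow> (complex \<Rightarrow> complex) \<Rightarrow> (complex \<Rightarrow> complex)"
  where "mult_op \<phi> = (\<lambda>f\<in>hardy_space. \<lambda>z. \<phi> z * f z)"

definition berezin_range ::
    "real \<Rightarrow> ((complex \<Rightarrow> complex) \<Rightarrow> (complex \<Rightarrow> complex)) \<Rightarrow> complex set"
  where "berezin_range q T =
    {hardy_inner (T (normalized_kernel w1)) (normalized_kernel w2) | w1 w2.
       w1 \<in> unit_disc \<and> w2 \<in> unit_disc \<and>
       hardy_inner (normalized_kernel w1) (normalized_kernel w2) = of_real q}"

end

theory Submission
  imports Defs
begin

text \<open>
  By the reproducing property, the \<open>(w1, w2)\<close> entry of the \<open>q\<close>-Berezin range of \<open>M_\<phi>\<close> is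
  \<open>\<phi>(w2)\<close> times the inner product of the two normalized kernels, that is, \<open>q \<phi>(w2)\<close>. Moving
  \<open>w1\<close> from \<open>w2\<close> radially to the unit circle, this inner product decreases continuously from 1
  to 0, so every \<open>w2\<close> occurs. Hence the range is \<open>q \<phi>(D)\<close> for the unit disc \<open>D\<close>.
\<close>

lemma fps_inverse_one_minus_const_X:
  fixes a :: "'a::field"
  shows "inverse (1 - fps_const a * fps_X) = Abs_fps (\<lambda>n. a ^ n)"
proof (rule fps_inverse_unique)
  show "(1 - fps_const a * fps_X) * Abs_fps (\<lambda>n. a ^ n) = 1"
  proof (rule fps_ext)
    fix n
    show "fps_nth ((1 - fps_const a * fps_X) * Abs_fps (\<lambda>n. a ^ n)) n = fps_nth 1 n"
      by (cases n) (simp_all add: left_diff_distrib mult.assoc)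
  qed
qed

text \<open>Taylor coefficients depend only on the germ at 0, where the cutoff outside the disc is
  invisible and the kernel is a geometric series. The divisor \<open>c\<close> lets one formula
  serve both the kernel and its normalization.\<close>

lemma taylor_coeff_szego_kernel_divide:
  "taylor_coeff (\<lambda>z. szego_kernel w z / c) n = cnj w ^ n / c"
proof -
  have "(\<lambda>z. inverse (1 - cnj w * z) * (1 / c)) has_fps_expansion
      inverse (1 - fps_const (cnj w) * fps_X) * fps_const (1 / c)"
    by (intro fps_expansion_intros) simp
  moreover have "\<forall>\<^sub>F z in nhds 0. szego_kernel w z / c = inverse (1 - cnj w * z) * (1 / c)"
    using eventually_nhds_in_open[of unit_disc 0]
    by (auto simp: szego_kernel_def field_simps elim!: eventually_mono)
  ultimately have "(\<lambda>z. szego_kernel w z / c) has_fps_expansion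
      inverse (1 - fps_const (cnj w) * fps_X) * fps_const (1 / c)"
    by (simp only: has_fps_expansion_cong)
  from fps_expansion_eqI[OF this] show ?thesis
    by (simp add: fps_inverse_one_minus_const_X)
qed

text \<open>Reproducing property: conjugating the coefficients of the kernel gives
  \<open>w ^ n\<close>, so the inner product is the power series of \<open>f\<close> at
  \<open>w\<close>. Since holomorphy alone yields its convergence, the result applies directly to
  \<phi> times a kernel.\<close>

lemma hardy_inner_szego_kernel_divide:
  assumes "f holomorphic_on unit_disc" and "w \<in> unit_disc"
  shows "hardy_inner f (\<lambda>z. szego_kernel w z / of_real c) = f w / of_real c"
proof -
  have "(\<lambda>n. taylor_coeff f n * w ^ n) sums f w"
    using holomorphic_power_series[OF assms] by (simp add: fps_expansion_def)
  from sums_divide[OF this, of "of_real c"] show ?thesis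
    by (simp add: hardy_inner_def taylor_coeff_szego_kernel_divide sums_iff)
qed

lemma one_minus_cnj_mult_nonzero:
  assumes "w \<in> unit_disc" and "z \<in> unit_disc"
  shows "1 - cnj w * z \<noteq> 0"
proof
  assume "1 - cnj w * z = 0"
  then have "norm (cnj w * z) = 1" by simp
  moreover have "norm w * norm z < 1 * 1"
    using assms by (intro mult_strict_mono') auto
  ultimately show False by (simp add: norm_mult)
qed

lemma szego_kernel_divide_holomorphic:
  assumes "w \<in> unit_disc"
  shows "(\<lambda>z. szego_kernel w z / of_real c) holomorphic_on unit_disc"
proof -
  have "(\<lambda>z. 1 / (1 - cnj w * z) * (1 / of_real c)) holomorphic_on unit_disc"
    using one_minus_cnj_mult_nonzero[OF assms] by (intro holomorphic_intros) auto
  then show ?thesis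
    by (rule holomorphic_transform) (simp add: szego_kernel_def)
qed

text \<open>Pairing the kernel with itself evaluates it at its own point \<open>w\<close>, which
  gives the squared norm.\<close>

lemma hardy_norm_szego_kernel:
  assumes "w \<in> unit_disc"
  shows "hardy_norm (szego_kernel w) = 1 / sqrt (1 - (norm w)\<^sup>2)"
proof -
  have "hardy_inner (szego_kernel w) (szego_kernel w) = szego_kernel w w"
    using hardy_inner_szego_kernel_divide[of "szego_kernel w" w 1]
      szego_kernel_divide_holomorphic[OF assms, of 1] assms by simp
  also have "\<dots> = of_real (1 / (1 - (norm w)\<^sup>2))"
    using assms by (simp add: szego_kernel_def mult.commute complex_norm_square[symmetric])
  finally show ?thesis
    by (simp add: hardy_norm_def real_sqrt_divide)
qed

lemma normalized_kernel_eq: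
  "normalized_kernel w = (\<lambda>z. szego_kernel w z / of_real (hardy_norm (szego_kernel w)))"
  by (simp add: normalized_kernel_def fun_eq_iff)

text \<open>Required to unfold \<open>mult_op\<close>, which is specified only on
  \<open>hardy_space\<close>. The squared coefficients form a geometric series of ratio
  \<open>(norm w)\<^sup>2\<close>.\<close>

lemma normalized_kernel_in_hardy_space:
  assumes "w \<in> unit_disc"
  shows "normalized_kernel w \<in> hardy_space"
proof -
  let ?c = "hardy_norm (szego_kernel w)"
  have "(norm w)\<^sup>2 < 1"
    using assms by (simp add: abs_square_less_1)
  then have "summable (\<lambda>n. ((norm w)\<^sup>2) ^ n * (1 / ?c\<^sup>2))"
    by (intro summable_mult2 summable_geometric) simp
  then have "summable (\<lambda>n. (norm (cnj w ^ n / of_real ?c))\<^sup>2)"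
    by (simp add: norm_divide norm_power power_divide power_mult[symmetric] mult.commute)
  then show ?thesis
    using szego_kernel_divide_holomorphic[OF assms]
    by (simp add: hardy_space_def normalized_kernel_eq taylor_coeff_szego_kernel_divide)
      (simp add: szego_kernel_def)
qed

lemma hardy_inner_normalized_kernel:
  assumes "f holomorphic_on unit_disc" and "w \<in> unit_disc"
  shows "hardy_inner f (normalized_kernel w) = f w * of_real (sqrt (1 - (norm w)\<^sup>2))"
  unfolding normalized_kernel_eq hardy_inner_szego_kernel_divide[OF assms]
  using assms(2) by (simp add: hardy_norm_szego_kernel)

lemma normalized_kernel_holomorphic:
  "w \<in> unit_disc \<Longrightarrow> normalized_kernel w holomorphic_on unit_disc"
  using normalized_kernel_in_hardy_space by (simp add: hardy_space_def)

text \<open>Both inner products are evaluations at \<open>w2\<close> with the same normalizing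
  factor, so the value of \<phi> at \<open>w2\<close> splits off.\<close>

lemma hardy_inner_mult_op_normalized_kernel:
  assumes "\<phi> holomorphic_on unit_disc" and "w1 \<in> unit_disc" and "w2 \<in> unit_disc"
  shows "hardy_inner (mult_op \<phi> (normalized_kernel w1)) (normalized_kernel w2) =
    \<phi> w2 * hardy_inner (normalized_kernel w1) (normalized_kernel w2)"
proof -
  have "(\<lambda>z. \<phi> z * normalized_kernel w1 z) holomorphic_on unit_disc"
    using assms normalized_kernel_holomorphic by (intro holomorphic_intros) auto
  then show ?thesis
    using assms
    by (simp add: mult_op_def normalized_kernel_in_hardy_space normalized_kernel_holomorphic
        hardy_inner_normalized_kernel)
qed

lemma hardy_inner_normalized_kernels:
  assumes "w1 \<in> unit_disc" and "w2 \<in> unit_disc"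
  shows "hardy_inner (normalized_kernel w1) (normalized_kernel w2) =
    of_real (sqrt (1 - (norm w1)\<^sup>2)) * of_real (sqrt (1 - (norm w2)\<^sup>2)) / (1 - cnj w1 * w2)"
  using assms
  by (simp add: hardy_inner_normalized_kernel normalized_kernel_holomorphic)
    (simp add: normalized_kernel_def hardy_norm_szego_kernel szego_kernel_def)

lemma ex_normalized_kernel_inner_eq:
  assumes "0 < q" and "q \<le> 1" and "w2 \<in> unit_disc"
  shows "\<exists>w1 \<in> unit_disc. hardy_inner (normalized_kernel w1) (normalized_kernel w2) = of_real q"
proof -
  define r where "r = norm w2"
  \<comment> \<open>The direction of \<open>w2\<close>; at the origin \<open>sgn\<close> would be 0,
    and the unit vector 1 is chosen instead.\<close>
  define u where "u = (if w2 = 0 then 1 else sgn w2)"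
  have r: "0 \<le> r" "r < 1" and u: "norm u = 1" "w2 = of_real r * u"
    using assms(3) by (auto simp: r_def u_def norm_divide sgn_eq)
  \<comment> \<open>The inner product for \<open>w1 = of_real t * u\<close>: on a common ray,
    \<open>cnj w1 * w2\<close> is the real number \<open>t * r\<close>.\<close>
  define g where "g t = sqrt (1 - t\<^sup>2) * sqrt (1 - r\<^sup>2) / (1 - t * r)" for t
  have nz: "1 - t * r \<noteq> 0" if "t \<in> {r..1}" for t
  proof -
    have "t * r \<le> 1 * r" using that r by (intro mult_right_mono) auto
    then show ?thesis using r by simp
  qed
  have "r\<^sup>2 < 1" using r by (simp add: abs_square_less_1)
  then have "g r = 1" by (simp add: g_def power2_eq_square)
  moreover have "g 1 = 0" by (simp add: g_def)
  moreover have "continuous_on {r..1} g"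
    unfolding g_def using nz by (intro continuous_intros) auto
  ultimately obtain t where t: "r \<le> t" "t \<le> 1" "g t = q"
    using IVT2'[of g 1 q r] assms r by auto
  \<comment> \<open>Positivity of \<open>q\<close> excludes the endpoint, which keeps
    \<open>w1\<close> inside the open disc.\<close>
  with \<open>g 1 = 0\<close> assms have "t < 1" by (cases "t = 1") auto
  define w1 where "w1 = of_real t * u"
  have n1: "norm w1 = t" using t r u by (simp add: w1_def norm_mult)
  then have w1: "w1 \<in> unit_disc" using \<open>t < 1\<close> by simp
  have "cnj u * u = 1" using u(1) by (metis complex_norm_square mult.commute of_real_1 power_one)
  then have "cnj w1 * w2 = of_real (t * r)"
    by (simp add: w1_def u(2) mult_ac)
  then have "hardy_inner (normalized_kernel w1) (normalized_kernel w2) = of_real (g t)"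
    using w1 assms(3) by (simp add: hardy_inner_normalized_kernels n1 g_def flip: r_def)
  with t w1 show ?thesis by auto
qed

lemma berezin_range_mult_op:
  assumes "0 < q" and "q \<le> 1" and "\<phi> holomorphic_on unit_disc"
  shows "berezin_range q (mult_op \<phi>) = (*\<^sub>R) q ` \<phi> ` unit_disc"
proof
  show "berezin_range q (mult_op \<phi>) \<subseteq> (*\<^sub>R) q ` \<phi> ` unit_disc"
    unfolding berezin_range_def
    by (auto simp del: mem_ball simp: hardy_inner_mult_op_normalized_kernel[OF assms(3)]
        scaleR_conv_of_real mult.commute)
next
  show "(*\<^sub>R) q ` \<phi> ` unit_disc \<subseteq> berezin_range q (mult_op \<phi>)"
  proof clarify
    fix w2 assume w2: "w2 \<in> unit_disc"
    with ex_normalized_kernel_inner_eq[OF assms(1,2)] obtain w1 where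
      w1: "w1 \<in> unit_disc" "hardy_inner (normalized_kernel w1) (normalized_kernel w2) = of_real q"
      by blast
    then have "q *\<^sub>R \<phi> w2 = hardy_inner (mult_op \<phi> (normalized_kernel w1)) (normalized_kernel w2)"
      using w2 assms(3)
      by (simp only: hardy_inner_mult_op_normalized_kernel scaleR_conv_of_real mult.commute)
    with w1 w2 show "q *\<^sub>R \<phi> w2 \<in> berezin_range q (mult_op \<phi>)"
      unfolding berezin_range_def by blast
  qed
qed

theorem corollary3p13:
  fixes q :: real and \<phi> :: "complex \<Rightarrow> complex"
  assumes "0 < q" and "q \<le> 1" and "\<phi> \<in> H_infinity"
  shows "convex (berezin_range q (mult_op \<phi>)) \<longleftrightarrow> convex (\<phi> ` unit_disc)"
proof -
  have range: "berezin_range q (mult_op \<phi>) = (*\<^sub>R) q ` \<phi> ` unit_disc"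
    using assms by (intro berezin_range_mult_op) (simp_all add: H_infinity_def)
  show ?thesis
  proof
    assume "convex (berezin_range q (mult_op \<phi>))"
    \<comment> \<open>Scaling by \<open>inverse q\<close> undoes the factor \<open>q\<close>, as
      \<open>q\<close> is nonzero.\<close>
    then have "convex ((*\<^sub>R) (inverse q) ` (*\<^sub>R) q ` \<phi> ` unit_disc)"
      unfolding range by (rule convex_scaling)
    then show "convex (\<phi> ` unit_disc)"
      using assms(1) by (simp add: image_image)
  next
    assume "convex (\<phi> ` unit_disc)"
    then show "convex (berezin_range q (mult_op \<phi>))"
      unfolding range by (rule convex_scaling)
  qed
qed

end
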